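(* Let $0<\alpha<1$ and $0<p<1$. The distribution function $G_{\alpha,p}(x)$ is infinitely differentiable in $(0,1)$, and its derivative satisfies $$G_{\alpha,p}'(x) \sim \frac{\sin \alpha\pi}{\pi}\cdot\frac{1-p}{p^2}\cdot\frac{\alpha\,\Gamma(\alpha)^2}{\Gamma(2\alpha)}\,x^{2\alpha-1}\qquad\text{as } x\to 0+ .$$
   Context: For $0<\alpha<1$ and $0<p<1$, the function $G_{\alpha,p}$ is given by $$G_{\alpha,p}(x)=\int_0^x (x-t)^{\alpha-1} g_{\alpha,p}(t)\,dt,\qquad 0\le x\le 1,$$ where, for $0<t<1$, $$g_{\alpha,p}(t)=\frac{\sin\alpha\pi}{\pi}\cdot\frac{(1-p)\,t^{\alpha}}{p^2(1-t)^{2\alpha}+(1-p)^2t^{2\alpha}+2p(1-p)t^{\alpha}(1-t)^{\alpha}\cos\alpha\pi}.$$ (It is the distribution function on $(0,1)$ characterized by $\int_0^1 \frac{dG_{\alpha,p}(x)}{(\lambda+x)^{\alpha}}=\frac{1}{p(1+\lambda)^{\alpha}+(1-p)\lambda^{\alpha}}$ for all $\lambda>0$.) For functions $f,g$ defined and nonvanishing on $(0,\varepsilon)$ for some $\varepsilon>0$, $f(x)\sim g(x)$ as $x\to0+$ means $\lim_{x\to0+}f(x)/g(x)=1$. $\Gamma$ is the Gamma function. *)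

theory Defs
  imports "HOL-Analysis.Analysis" "HOL-Library.Landau_Symbols"
begin

definition g_dens :: "real \<Rightarrow> real \<Rightarrow> real \<Rightarrow> real" where
  "g_dens \<alpha> p t =
     sin (\<alpha> * pi) / pi *
     ((1 - p) * t powr \<alpha> /
       (p\<^sup>2 * (1 - t) powr (2 * \<alpha>) + (1 - p)\<^sup>2 * t powr (2 * \<alpha>)
         + 2 * p * (1 - p) * t powr \<alpha> * (1 - t) powr \<alpha> * cos (\<alpha> * pi)))"

(* The integral is taken over the open interval, so that g_dens is only evaluated on (0,1)
   and the singularity of the kernel at t = x is avoided. Only the values for 0 \<le> x \<le> 1
   are meaningful. *)
definition G_distr :: "real \<Rightarrow> real \<Rightarrow> real \<Rightarrow> real" where
  "G_distr \<alpha> p x = (LBINT t:{0<..<x}. (x - t) powr (\<alpha> - 1) * g_dens \<alpha> p t)"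

(* Intended for open S, where the iterated derivatives at points of S depend only on f
   restricted to S. *)
definition infinitely_differentiable_on :: "(real \<Rightarrow> real) \<Rightarrow> real set \<Rightarrow> bool" where
  "infinitely_differentiable_on f S \<longleftrightarrow>
     (\<forall>n. \<forall>x\<in>S. (deriv ^^ n) f field_differentiable (at x))"

end

theory Submission
  imports Defs
begin

text \<open>
  Write \<open>g(t) = t\<^sup>\<alpha> h(t)\<close>. The substitution \<open>t = x u\<close> turns the convolution into
  \<open>G(x) = x\<^sup>2\<^sup>\<alpha> \<Phi>\<^sub>h(x)\<close> with \<open>\<Phi>\<^sub>f(x) = \<integral>\<^sub>0\<^sup>1 u\<^sup>\<alpha> (1 - u)\<^sup>\<alpha>\<^sup>-\<^sup>1 f(x u) du\<close>: the singularities of the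
  kernel and of the density now sit in a fixed integrable weight, and \<open>x\<close> enters only through \<open>h\<close>.

  Ordinary derivatives of \<open>h\<close> blow up at \<open>0\<close> in general, since \<open>h\<close> involves \<open>t\<^sup>\<alpha>\<close>. The Euler operator
  \<open>\<theta> = t d/dt\<close>, however, maps \<open>t\<^sup>\<alpha>\<close> to \<open>\<alpha> t\<^sup>\<alpha>\<close>, so all \<open>\<theta>\<^sup>n h\<close> have limits at \<open>0\<close>; and \<open>\<theta>\<close> commutes
  with the dilations \<open>t \<mapsto> u t\<close>, whence \<open>x \<Phi>\<^sub>f' = \<Phi>\<^sub>\<theta>\<^sub>f\<close> by dominated convergence
  (\<open>has_derivative_weighted_dilation\<close>). The inductive class \<open>tame\<close> is an algebra of functions that
  contains \<open>h\<close>, is stable under \<open>\<theta>\<close>, and whose members have a limit at \<open>0\<close>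
  (\<open>tame_euler\<close>, \<open>tame_has_limit\<close>). Consequently
  \<open>(x\<^sup>\<beta> \<Phi>\<^sub>f)' = x\<^sup>\<beta>\<^sup>-\<^sup>1 \<Phi>\<^sub>q\<close> where \<open>q = \<beta> f + \<theta> f\<close> is again tame; iterating this gives smoothness.

  For the asymptotics the first step of that iteration is enough: \<open>G'(x) = x\<^sup>2\<^sup>\<alpha>\<^sup>-\<^sup>1 \<Phi>\<^sub>k(x)\<close> with
  \<open>k = 2 \<alpha> h + \<theta> h\<close>. As \<open>\<theta> h\<close> vanishes at \<open>0\<close>, \<open>\<Phi>\<^sub>k(x)\<close> tends to \<open>2 \<alpha> h(0+)\<close> times the
  total mass \<open>B(\<alpha> + 1, \<alpha>) = \<Gamma>(\<alpha>)\<^sup>2 / (2 \<Gamma>(2\<alpha>))\<close> of the weight.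
\<close>

section \<open>Functions stable under the Euler operator\<close>

text \<open>
  The generators are chosen to make the class closed under \<open>t d/dt\<close> on \<open>(0,1)\<close>. An exponent of \<open>t\<close>
  must be positive for a limit at \<open>0\<close> to exist, while an exponent of \<open>1 - t\<close> is unrestricted because
  differentiation lowers it and nothing is claimed near \<open>1\<close>.
\<close>

inductive tame :: "(real \<Rightarrow> real) \<Rightarrow> bool" where
  const: "tame (\<lambda>_. c)"
| powr: "0 < \<gamma> \<Longrightarrow> tame (\<lambda>t. t powr \<gamma>)"
| one_minus_powr: "tame (\<lambda>t. (1 - t) powr \<gamma>)"
| add: "tame f \<Longrightarrow> tame g \<Longrightarrow> tame (\<lambda>t. f t + g t)"
| mult: "tame f \<Longrightarrow> tame g \<Longrightarrow> tame (\<lambda>t. f t * g t)"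
| inverse: "tame f \<Longrightarrow> (\<And>t. 0 < t \<Longrightarrow> t < 1 \<Longrightarrow> f t \<noteq> 0) \<Longrightarrow>
    (f \<longlongrightarrow> L) (at_right 0) \<Longrightarrow> L \<noteq> 0 \<Longrightarrow> tame (\<lambda>t. inverse (f t))"

lemma powr_tendsto_0_at_right:
  fixes \<gamma> :: real
  assumes "0 < \<gamma>"
  shows "((\<lambda>t. t powr \<gamma>) \<longlongrightarrow> 0) (at_right 0)"
proof -
  have "((\<lambda>t. t powr \<gamma>) \<longlongrightarrow> 0 powr \<gamma>) (at_right 0)"
    using assms
    by (intro tendsto_powr2 tendsto_ident_at tendsto_const)
      (auto simp: eventually_at_filter)
  then show ?thesis by simp
qed

lemma one_minus_powr_tendsto_1_at_right:
  fixes \<gamma> :: real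
  shows "((\<lambda>t. (1 - t) powr \<gamma>) \<longlongrightarrow> 1) (at_right 0)"
proof -
  have "((\<lambda>t. (1 - t) powr \<gamma>) \<longlongrightarrow> (1 - 0) powr \<gamma>) (at_right 0)"
    by (intro tendsto_powr tendsto_intros) auto
  then show ?thesis by simp
qed

lemma tame_has_limit:
  assumes "tame f"
  obtains L where "(f \<longlongrightarrow> L) (at_right 0)"
proof -
  have "\<exists>L. (f \<longlongrightarrow> L) (at_right 0)"
    using assms
  proof induction
    case (powr \<gamma>)
    then show ?case using powr_tendsto_0_at_right by blast
  next
    case (one_minus_powr \<gamma>)
    show ?case using one_minus_powr_tendsto_1_at_right by blast
  next
    case (inverse f L)
    then show ?case using tendsto_inverse by blast
  qed (auto intro: tendsto_intros)
  then show ?thesis using that by blast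
qed

text \<open>
  The witness \<open>e\<close> is \<open>t f'(t)\<close>, which satisfies the Leibniz rule and is therefore computed along the
  generation of \<open>f\<close>. Its vanishing at \<open>0\<close>, which later isolates the leading term of the
  asymptotics, goes along in the same induction: it holds for the generators, and the Leibniz rule
  preserves it because all factors have limits.
\<close>

lemma tame_euler:
  assumes "tame f"
  obtains e where "tame e" "(e \<longlongrightarrow> 0) (at_right 0)"
    "\<And>t. 0 < t \<Longrightarrow> t < 1 \<Longrightarrow> (f has_field_derivative e t / t) (at t)"
proof -
  have "\<exists>e. tame e \<and> (e \<longlongrightarrow> 0) (at_right 0) \<and>
      (\<forall>t. 0 < t \<longrightarrow> t < 1 \<longrightarrow> (f has_field_derivative e t / t) (at t))"
    using assms
  proof induction
    case (const c)
    show ?case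
      by (rule exI[of _ "\<lambda>_. 0"]) (auto intro: tame.const)
  next
    case (powr \<gamma>)
    have "tame (\<lambda>t. \<gamma> * t powr \<gamma>)"
      using powr by (intro tame.intros)
    moreover have "((\<lambda>t. \<gamma> * t powr \<gamma>) \<longlongrightarrow> 0) (at_right 0)"
      using tendsto_mult[OF tendsto_const powr_tendsto_0_at_right[OF powr]] by simp
    moreover have "((\<lambda>t. t powr \<gamma>) has_field_derivative \<gamma> * t powr \<gamma> / t) (at t)"
      if "0 < t" for t :: real
      using has_real_derivative_powr[OF that, of \<gamma>] that by (simp add: powr_diff)
    ultimately show ?case by blast
  next
    case (one_minus_powr \<gamma>)
    let ?e = "\<lambda>t::real. (- \<gamma> * t powr 1) * (1 - t) powr (\<gamma> - 1)"
    have "tame ?e"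
      by (intro tame.intros) simp
    moreover have "(?e \<longlongrightarrow> (- \<gamma> * 0) * 1) (at_right 0)"
      by (intro tendsto_intros powr_tendsto_0_at_right one_minus_powr_tendsto_1_at_right) simp
    moreover have "((\<lambda>t. (1 - t) powr \<gamma>) has_field_derivative ?e t / t) (at t)"
      if "0 < t" "t < 1" for t :: real
      using that by (auto intro!: derivative_eq_intros simp: powr_diff)
    ultimately show ?case by auto
  next
    case (add f g)
    then obtain e1 e2 where e: "tame e1" "(e1 \<longlongrightarrow> 0) (at_right 0)"
      "\<And>t. 0 < t \<Longrightarrow> t < 1 \<Longrightarrow> (f has_field_derivative e1 t / t) (at t)"
      "tame e2" "(e2 \<longlongrightarrow> 0) (at_right 0)"
      "\<And>t. 0 < t \<Longrightarrow> t < 1 \<Longrightarrow> (g has_field_derivative e2 t / t) (at t)"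
      by blast
    have "tame (\<lambda>t. e1 t + e2 t)" using e by (intro tame.intros)
    moreover have "((\<lambda>t. e1 t + e2 t) \<longlongrightarrow> 0) (at_right 0)"
      using tendsto_add[OF e(2,5)] by simp
    moreover have "((\<lambda>t. f t + g t) has_field_derivative (e1 t + e2 t) / t) (at t)"
      if "0 < t" "t < 1" for t
      using DERIV_add[OF e(3)[OF that] e(6)[OF that]] by (simp add: add_divide_distrib)
    ultimately show ?case by blast
  next
    case (mult f g)
    then obtain e1 e2 where e: "tame e1" "(e1 \<longlongrightarrow> 0) (at_right 0)"
      "\<And>t. 0 < t \<Longrightarrow> t < 1 \<Longrightarrow> (f has_field_derivative e1 t / t) (at t)"
      "tame e2" "(e2 \<longlongrightarrow> 0) (at_right 0)"
      "\<And>t. 0 < t \<Longrightarrow> t < 1 \<Longrightarrow> (g has_field_derivative e2 t / t) (at t)"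
      by blast
    obtain L1 where L1: "(f \<longlongrightarrow> L1) (at_right 0)" using tame_has_limit[OF mult(1)] .
    obtain L2 where L2: "(g \<longlongrightarrow> L2) (at_right 0)" using tame_has_limit[OF mult(2)] .
    have "tame (\<lambda>t. e1 t * g t + e2 t * f t)" using e mult by (intro tame.intros)
    moreover have "((\<lambda>t. e1 t * g t + e2 t * f t) \<longlongrightarrow> 0 * L2 + 0 * L1) (at_right 0)"
      by (intro tendsto_intros e L1 L2)
    moreover have "((\<lambda>t. f t * g t) has_field_derivative (e1 t * g t + e2 t * f t) / t) (at t)"
      if "0 < t" "t < 1" for t
      using DERIV_mult[OF e(3)[OF that] e(6)[OF that]] by (simp add: add_divide_distrib)
    ultimately show ?case by auto
  next
    case (inverse f L)
    then obtain e where e: "tame e" "(e \<longlongrightarrow> 0) (at_right 0)"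
      "\<And>t. 0 < t \<Longrightarrow> t < 1 \<Longrightarrow> (f has_field_derivative e t / t) (at t)"
      by blast
    let ?e = "\<lambda>t. (- 1 * e t) * (inverse (f t) * inverse (f t))"
    have "tame ?e"
      using e inverse by (intro tame.mult tame.const tame.inverse[of f L]) auto
    moreover have "(?e \<longlongrightarrow> (- 1 * 0) * (inverse L * inverse L)) (at_right 0)"
      using e inverse by (intro tendsto_intros) auto
    moreover have "((\<lambda>t. inverse (f t)) has_field_derivative ?e t / t) (at t)"
      if "0 < t" "t < 1" for t
      using DERIV_inverse'[OF e(3)[OF that] inverse(2)[OF that]] by (simp add: ac_simps)
    ultimately show ?case by auto
  qed
  then show ?thesis using that by blast
qed

lemma tame_continuous_on:
  assumes "tame f"
  shows "continuous_on {0<..<1} f"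
proof -
  obtain e where "\<And>t. 0 < t \<Longrightarrow> t < 1 \<Longrightarrow> (f has_field_derivative e t / t) (at t)"
    using tame_euler[OF assms] by blast
  then show ?thesis
    by (intro continuous_at_imp_continuous_on ballI) (auto intro: DERIV_isCont)
qed

text \<open>
  Continuity on \<open>(0,1)\<close> and a limit at \<open>0\<close> leave only the right end point, where powers of \<open>1 - t\<close> may
  blow up; hence the restriction to \<open>b < 1\<close>.
\<close>

lemma tame_bounded:
  assumes "tame f" "b < 1"
  obtains M where "0 \<le> M" "\<And>t. 0 < t \<Longrightarrow> t \<le> b \<Longrightarrow> \<bar>f t\<bar> \<le> M"
proof -
  obtain L where L: "(f \<longlongrightarrow> L) (at_right 0)" using tame_has_limit[OF assms(1)] .
  then have "((\<lambda>t. \<bar>f t\<bar>) \<longlongrightarrow> \<bar>L\<bar>) (at_right 0)" by (intro tendsto_intros)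
  then have "\<forall>\<^sub>F t in at_right 0. \<bar>f t\<bar> < \<bar>L\<bar> + 1" by (rule order_tendstoD) simp
  then obtain d where d: "0 < d" "\<And>t. 0 < t \<Longrightarrow> t < d \<Longrightarrow> \<bar>f t\<bar> < \<bar>L\<bar> + 1"
    by (auto simp: eventually_at_right_field)
  have "continuous_on {d..b} f"
    using tame_continuous_on[OF assms(1)] by (rule continuous_on_subset) (use d assms in auto)
  then have "bounded (f ` {d..b})"
    by (intro compact_imp_bounded compact_continuous_image) auto
  then obtain B where B: "\<And>t. d \<le> t \<Longrightarrow> t \<le> b \<Longrightarrow> \<bar>f t\<bar> \<le> B"
    by (fastforce simp: bounded_iff)
  show ?thesis
  proof
    show "0 \<le> max (\<bar>L\<bar> + 1) B" by simp
    show "\<bar>f t\<bar> \<le> max (\<bar>L\<bar> + 1) B" if "0 < t" "t \<le> b" for t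
      using d(2)[of t] B[of t] that by (cases "t < d") (auto simp: less_imp_le max_def)
  qed
qed

section \<open>Weighted averages of dilations\<close>

text \<open>
  The weight carries all the unboundedness of the integrand, so \<open>M * \<bar>w u\<bar>\<close> is a majorant. The filter
  is general so that limits at \<open>0+\<close> and limits of difference quotients are both instances.
\<close>

lemma weighted_dominated_convergence:
  fixes w k :: "real \<Rightarrow> real" and K :: "'a::first_countable_topology \<Rightarrow> real \<Rightarrow> real"
  assumes S: "S \<in> sets borel" and w: "set_integrable lborel S w"
    and K: "\<forall>\<^sub>F h in at a within T. continuous_on S (K h) \<and> (\<forall>u\<in>S. \<bar>K h u\<bar> \<le> M)"
    and k: "continuous_on S k"
    and lim: "\<And>u. u \<in> S \<Longrightarrow> ((\<lambda>h. K h u) \<longlongrightarrow> k u) (at a within T)"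
  shows "((\<lambda>h. LBINT u:S. w u * K h u) \<longlongrightarrow> (LBINT u:S. w u * k u)) (at a within T)"
  unfolding tendsto_at_iff_sequentially comp_def
proof safe
  fix X :: "nat \<Rightarrow> 'a"
  assume X: "\<forall>i. X i \<in> T - {a}" "X \<longlonglongrightarrow> a"
  have fX: "filterlim X (at a within T) sequentially"
    using X by (auto simp: filterlim_at)
  have "\<forall>\<^sub>F n in sequentially. continuous_on S (K (X n)) \<and> (\<forall>u\<in>S. \<bar>K (X n) u\<bar> \<le> M)"
    using fX K by (auto simp: filterlim_iff)
  then obtain N where N: "\<And>n. N \<le> n \<Longrightarrow> continuous_on S (K (X n))"
    "\<And>n u. N \<le> n \<Longrightarrow> u \<in> S \<Longrightarrow> \<bar>K (X n) u\<bar> \<le> M"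
    by (auto simp: eventually_sequentially)
  have meas: "(\<lambda>u. indicator S u *\<^sub>R (w u * f u)) \<in> borel_measurable lborel"
    if "continuous_on S f" for f
  proof -
    have "(\<lambda>u. indicator S u *\<^sub>R w u) \<in> borel_measurable lborel"
      using w unfolding set_integrable_def by (rule borel_measurable_integrable)
    moreover have "(\<lambda>u. indicator S u *\<^sub>R f u) \<in> borel_measurable lborel"
      using borel_measurable_continuous_on_indicator[OF S that] by simp
    ultimately have "(\<lambda>u. (indicator S u *\<^sub>R w u) * (indicator S u *\<^sub>R f u)) \<in> borel_measurable lborel"
      by (rule borel_measurable_times)
    moreover have "(\<lambda>u. (indicator S u *\<^sub>R w u) * (indicator S u *\<^sub>R f u)) =
        (\<lambda>u. indicator S u *\<^sub>R (w u * f u))"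
      by (auto simp: indicator_def)
    ultimately show ?thesis by simp
  qed
  show "(\<lambda>n. LBINT u:S. w u * K (X n) u) \<longlonglongrightarrow> (LBINT u:S. w u * k u)"
    unfolding set_lebesgue_integral_def
  proof (rule LIMSEQ_offset[of _ N],
      rule integral_dominated_convergence[where w = "\<lambda>u. M * \<bar>indicator S u *\<^sub>R w u\<bar>"])
    show "integrable lborel (\<lambda>u. M * \<bar>indicator S u *\<^sub>R w u\<bar>)"
      using w unfolding set_integrable_def by (intro integrable_mult_right integrable_abs)
    show "AE u in lborel. (\<lambda>n. indicator S u *\<^sub>R (w u * K (X (n + N)) u))
        \<longlonglongrightarrow> indicator S u *\<^sub>R (w u * k u)"
    proof (intro AE_I2)
      fix u
      show "(\<lambda>n. indicator S u *\<^sub>R (w u * K (X (n + N)) u)) \<longlonglongrightarrow> indicator S u *\<^sub>R (w u * k u)"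
      proof (cases "u \<in> S")
        case True
        have "(\<lambda>n. K (X n) u) \<longlonglongrightarrow> k u"
          using lim[OF True] fX by (rule filterlim_compose)
        then have "(\<lambda>n. K (X (n + N)) u) \<longlonglongrightarrow> k u" by (rule LIMSEQ_ignore_initial_segment)
        then show ?thesis by (intro tendsto_intros)
      qed simp
    qed
    show "AE u in lborel. norm (indicator S u *\<^sub>R (w u * K (X (n + N)) u))
        \<le> M * \<bar>indicator S u *\<^sub>R w u\<bar>" for n
    proof (intro AE_I2)
      fix u
      show "norm (indicator S u *\<^sub>R (w u * K (X (n + N)) u)) \<le> M * \<bar>indicator S u *\<^sub>R w u\<bar>"
        using mult_right_mono[OF N(2)[of "n + N" u], of "\<bar>w u\<bar>"]
        by (cases "u \<in> S") (auto simp: abs_mult mult.commute)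
    qed
  qed (use meas k N(1) in auto)
qed

definition weighted_dilation :: "(real \<Rightarrow> real) \<Rightarrow> (real \<Rightarrow> real) \<Rightarrow> real \<Rightarrow> real" where
  "weighted_dilation w f x = (LBINT u:{0<..<1}. w u * f (x * u))"

lemma continuous_on_dilation:
  fixes f :: "real \<Rightarrow> real"
  assumes "continuous_on {0<..<1} f" "0 < x" "x < 1"
  shows "continuous_on {0<..<1} (\<lambda>u. f (x * u))"
proof (rule continuous_on_compose2[OF assms(1)])
  show "(\<lambda>u. x * u) ` {0<..<1} \<subseteq> {0<..<1}"
    using assms mult_strict_mono[of x 1 _ 1] by auto
qed (intro continuous_intros)

lemma set_integrable_dilation:
  assumes w: "set_integrable lborel {0<..<1} w" and "tame f" and y: "0 < y" "y < 1"
  shows "set_integrable lborel {0<..<1} (\<lambda>u. w u * f (y * u))"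
proof -
  obtain B where B: "0 \<le> B" "\<And>t. 0 < t \<Longrightarrow> t \<le> y \<Longrightarrow> \<bar>f t\<bar> \<le> B"
    using tame_bounded[OF \<open>tame f\<close> y(2)] by blast
  have "set_integrable lborel {0<..<1} (\<lambda>u. B * w u)" using w by simp
  then show ?thesis
  proof (rule set_integrable_bound)
    have "(\<lambda>u. (indicator {0<..<1} u *\<^sub>R w u) * (indicator {0<..<1} u *\<^sub>R f (y * u)))
        \<in> borel_measurable lborel"
      using borel_measurable_integrable[OF w[unfolded set_integrable_def]]
        borel_measurable_continuous_on_indicator[OF _
          continuous_on_dilation[OF tame_continuous_on[OF \<open>tame f\<close>] y]]
      by (intro borel_measurable_times) auto
    moreover have "(\<lambda>u. (indicator {0<..<1} u *\<^sub>R w u) * (indicator {0<..<1} u *\<^sub>R f (y * u)))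
        = (\<lambda>u. indicator {0<..<1} u *\<^sub>R (w u * f (y * u)))"
      by (auto simp: indicator_def)
    ultimately show "set_borel_measurable lborel {0<..<1} (\<lambda>u. w u * f (y * u))"
      by (simp add: set_borel_measurable_def)
    have "norm (w u * f (y * u)) \<le> norm (B * w u)" if "0 < u" "u < 1" for u
      using mult_left_mono[OF B(2)[of "y * u"], of "\<bar>w u\<bar>"] that y B(1)
      by (simp add: abs_mult mult.commute)
    then show "AE u in lborel. u \<in> {0<..<1} \<longrightarrow> norm (w u * f (y * u)) \<le> norm (B * w u)"
      by (intro AE_I2) auto
  qed
qed

lemma weighted_dilation_tendsto_0:
  assumes w: "set_integrable lborel {0<..<1} w" and "tame f" and L: "(f \<longlongrightarrow> L) (at_right 0)"
  shows "(weighted_dilation w f \<longlongrightarrow> L * (LBINT u:{0<..<1}. w u)) (at_right 0)"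
proof -
  obtain M where M: "0 \<le> M" "\<And>t. 0 < t \<Longrightarrow> t \<le> 1/2 \<Longrightarrow> \<bar>f t\<bar> \<le> M"
    using tame_bounded[OF \<open>tame f\<close>, of "1/2"] by auto
  have "((\<lambda>x. LBINT u:{0<..<1}. w u * f (x * u)) \<longlongrightarrow> (LBINT u:{0<..<1}. w u * L)) (at_right 0)"
  proof (rule weighted_dominated_convergence[OF _ w])
    have "\<forall>\<^sub>F x in at_right (0::real). 0 < x \<and> x < 1/2"
      by (auto simp: eventually_at_right_field intro: exI[of _ "1/2"])
    then show "\<forall>\<^sub>F x in at_right 0. continuous_on {0<..<1} (\<lambda>u. f (x * u)) \<and>
        (\<forall>u\<in>{0<..<1}. \<bar>f (x * u)\<bar> \<le> M)"
    proof eventually_elim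
      case (elim x)
      have "\<bar>f (x * u)\<bar> \<le> M" if "0 < u" "u < 1" for u
        using elim that mult_mono[of x "1/2" u 1] by (intro M) auto
      then show ?case
        using elim continuous_on_dilation[OF tame_continuous_on[OF \<open>tame f\<close>], of x] by auto
    qed
    show "((\<lambda>x. f (x * u)) \<longlongrightarrow> L) (at_right 0)" if "u \<in> {0<..<1}" for u
    proof (rule filterlim_compose[OF L])
      have "((\<lambda>x. x * u) \<longlongrightarrow> 0 * u) (at_right 0)" by (intro tendsto_intros)
      moreover have "\<forall>\<^sub>F x in at_right 0. x * u \<in> {0<..} \<and> x * u \<noteq> 0"
        using eventually_at_right_less[of "0::real"] by eventually_elim (use that in auto)
      ultimately show "filterlim (\<lambda>x. x * u) (at_right 0) (at_right 0)"
        by (simp add: filterlim_at)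
    qed
  qed auto
  then show ?thesis
    unfolding weighted_dilation_def by (simp add: mult.commute)
qed

text \<open>
  The difference quotients are dominated by means of the mean value theorem: a quotient in \<open>x\<close> equals
  \<open>u f'(z u) = e(z u) / z\<close> for an intermediate \<open>z\<close>, so a bound for \<open>e\<close> on an initial interval
  bounds it uniformly in \<open>u\<close>, however fast \<open>f'\<close> grows at \<open>0\<close>.
\<close>

lemma has_derivative_weighted_dilation:
  assumes w: "set_integrable lborel {0<..<1} w" and "tame f" "tame e"
    and f: "\<And>t. 0 < t \<Longrightarrow> t < 1 \<Longrightarrow> (f has_field_derivative e t / t) (at t)"
    and x: "0 < x" "x < 1"
  shows "(weighted_dilation w f has_field_derivative weighted_dilation w e x / x) (at x)"
proof -
  have fu: "((\<lambda>y. f (y * u)) has_field_derivative e (z * u) / z) (at z)"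
    if "0 < u" "u < 1" "0 < z" "z < 1" for u z
  proof -
    have "z * u < 1" using mult_strict_mono[of z 1 u 1] that by simp
    then have "((\<lambda>y. f (y * u)) has_field_derivative e (z * u) / (z * u) * u) (at z)"
      using that by (intro DERIV_chain2[OF f]) (auto intro!: derivative_eq_intros)
    then show ?thesis using that by simp
  qed
  \<comment> \<open>All points \<open>z u\<close> with \<open>z\<close> within \<open>r\<close> of \<open>x\<close> stay below \<open>b < 1\<close>, and \<open>z\<close> stays above \<open>x / 2\<close>.\<close>
  define b where "b = (1 + x) / 2"
  define r where "r = min (x / 2) ((1 - x) / 2)"
  have br: "b < 1" "x + r \<le> b" "0 < r" "r \<le> x / 2" using x by (auto simp: b_def r_def min_def field_simps)
  obtain M where M: "0 \<le> M" "\<And>t. 0 < t \<Longrightarrow> t \<le> b \<Longrightarrow> \<bar>e t\<bar> \<le> M"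
    using tame_bounded[OF \<open>tame e\<close> br(1)] by blast
  let ?Q = "\<lambda>y u. (f (y * u) - f (x * u)) / (y - x)"
  have bound: "\<bar>?Q y u\<bar> \<le> M / (x / 2)" if "y \<noteq> x" "\<bar>y - x\<bar> < r" "0 < u" "u < 1" for y u
  proof -
    have near: "0 < z \<and> z < 1 \<and> x / 2 \<le> z \<and> z \<le> b" if "\<bar>z - x\<bar> < r" for z
      using that br x by (auto simp: abs_less_iff)
    have "\<exists>z. \<bar>z - x\<bar> < r \<and> ?Q y u = e (z * u) / z"
    proof (cases "x < y")
      case True
      have "\<exists>z. x < z \<and> z < y \<and> f (y * u) - f (x * u) = (y - x) * (e (z * u) / z)"
        using that x near[OF that(2)] True by (intro MVT2[where f = "\<lambda>y. f (y * u)"]) (auto intro!: fu)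
      then obtain z where z: "x < z" "z < y" "f (y * u) - f (x * u) = (y - x) * (e (z * u) / z)"
        by blast
      then show ?thesis using that by (intro exI[of _ z]) auto
    next
      case False
      then have "y < x" using that by simp
      then have "\<exists>z. y < z \<and> z < x \<and> f (x * u) - f (y * u) = (x - y) * (e (z * u) / z)"
        using that x near[OF that(2)] by (intro MVT2[where f = "\<lambda>y. f (y * u)"]) (auto intro!: fu)
      then obtain z where z: "y < z" "z < x" "f (x * u) - f (y * u) = (x - y) * (e (z * u) / z)"
        by blast
      then have "f (y * u) - f (x * u) = (y - x) * (e (z * u) / z)"
        unfolding left_diff_distrib by linarith
      then show ?thesis using z that by (intro exI[of _ z]) auto
    qed
    then obtain z where z: "\<bar>z - x\<bar> < r" "?Q y u = e (z * u) / z" by blast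
    note nz = near[OF z(1)]
    have "z * u \<le> b * 1" using nz that by (intro mult_mono) auto
    then have "\<bar>e (z * u)\<bar> \<le> M" using nz that by (intro M) auto
    then have "\<bar>e (z * u)\<bar> / \<bar>z\<bar> \<le> M / (x / 2)"
      using nz x M(1) by (intro frac_le) auto
    then show ?thesis by (simp add: z(2))
  qed
  have lim: "((\<lambda>y. LBINT u:{0<..<1}. w u * ?Q y u) \<longlongrightarrow>
      (LBINT u:{0<..<1}. w u * (e (x * u) / x))) (at x within UNIV)"
  proof (rule weighted_dominated_convergence[OF _ w])
    have "\<forall>\<^sub>F y in at x. y \<noteq> x \<and> \<bar>y - x\<bar> < r"
      using br by (auto simp: eventually_at dist_real_def)
    then show "\<forall>\<^sub>F y in at x. continuous_on {0<..<1} (?Q y) \<and>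
        (\<forall>u\<in>{0<..<1}. \<bar>?Q y u\<bar> \<le> M / (x / 2))"
    proof eventually_elim
      case (elim y)
      have "0 < y" "y < 1" using elim br x by (auto simp: abs_less_iff)
      then have "continuous_on {0<..<1} (?Q y)"
        using elim x
        by (intro continuous_intros continuous_on_dilation tame_continuous_on \<open>tame f\<close>) auto
      then show ?case using bound[of y] elim by auto
    qed
    show "continuous_on {0<..<1} (\<lambda>u. e (x * u) / x)"
      using x by (intro continuous_intros continuous_on_dilation tame_continuous_on \<open>tame e\<close>) auto
    show "((\<lambda>y. ?Q y u) \<longlongrightarrow> e (x * u) / x) (at x)" if "u \<in> {0<..<1}" for u
      using fu[of u x] that x by (simp add: has_field_derivative_iff)
  qed simp
  note integrable = set_integrable_dilation[OF w \<open>tame f\<close>]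
  have "\<forall>\<^sub>F y in at x. 0 < y \<and> y < 1 \<and> y \<noteq> x"
  proof -
    have "\<forall>\<^sub>F y in at x. y \<in> {0<..<1} \<and> y \<noteq> x"
      using eventually_at_in_open[of "{0<..<1}" x] x by simp
    then show ?thesis by (auto elim: eventually_mono)
  qed
  then have "\<forall>\<^sub>F y in at x. (LBINT u:{0<..<1}. w u * ?Q y u) =
      (weighted_dilation w f y - weighted_dilation w f x) / (y - x)"
  proof eventually_elim
    case (elim y)
    have "(LBINT u:{0<..<1}. w u * ?Q y u) =
        (LBINT u:{0<..<1}. (w u * f (y * u) - w u * f (x * u)) / (y - x))"
      by (simp add: right_diff_distrib)
    also have "\<dots> = (LBINT u:{0<..<1}. w u * f (y * u) - w u * f (x * u)) / (y - x)"
      by (rule set_integral_divide_zero)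
    also have "\<dots> = (weighted_dilation w f y - weighted_dilation w f x) / (y - x)"
      using integrable[of x] integrable[of y] elim x by (simp add: weighted_dilation_def set_integral_diff(2))
    finally show ?case .
  qed
  from tendsto_cong[OF this] lim
  have "((\<lambda>y. (weighted_dilation w f y - weighted_dilation w f x) / (y - x)) \<longlongrightarrow>
      (LBINT u:{0<..<1}. w u * (e (x * u) / x))) (at x)"
    by simp
  moreover have "(LBINT u:{0<..<1}. w u * (e (x * u) / x)) = weighted_dilation w e x / x"
    unfolding weighted_dilation_def
    using set_integral_divide_zero[of lborel "{0<..<1}" "\<lambda>u. w u * e (x * u)" x] by simp
  ultimately show ?thesis by (simp only: has_field_derivative_iff)
qed

text \<open>
  The power of \<open>x\<close> contributes \<open>\<beta> f\<close> and the average contributes \<open>e = t f'(t)\<close>. Both come with the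
  factor \<open>x powr (\<beta> - 1)\<close>, so the shape of the function is preserved and the lemma can be iterated.
\<close>

lemma has_derivative_powr_weighted_dilation:
  assumes w: "set_integrable lborel {0<..<1} w" and "tame f"
  obtains e where "tame e" "(e \<longlongrightarrow> 0) (at_right 0)"
    "\<And>x. 0 < x \<Longrightarrow> x < 1 \<Longrightarrow>
      ((\<lambda>x. x powr \<beta> * weighted_dilation w f x) has_field_derivative
        x powr (\<beta> - 1) * weighted_dilation w (\<lambda>t. \<beta> * f t + e t) x) (at x)"
proof -
  obtain e where e: "tame e" "(e \<longlongrightarrow> 0) (at_right 0)"
    "\<And>t. 0 < t \<Longrightarrow> t < 1 \<Longrightarrow> (f has_field_derivative e t / t) (at t)"
    using tame_euler[OF \<open>tame f\<close>] by blast
  have "((\<lambda>x. x powr \<beta> * weighted_dilation w f x) has_field_derivative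
      x powr (\<beta> - 1) * weighted_dilation w (\<lambda>t. \<beta> * f t + e t) x) (at x)"
    if x: "0 < x" "x < 1" for x
  proof -
    have "weighted_dilation w (\<lambda>t. \<beta> * f t + e t) x =
        (LBINT u:{0<..<1}. \<beta> * (w u * f (x * u)) + w u * e (x * u))"
      unfolding weighted_dilation_def by (simp add: algebra_simps)
    also have "\<dots> = \<beta> * weighted_dilation w f x + weighted_dilation w e x"
      using set_integrable_dilation[OF w \<open>tame f\<close> x] set_integrable_dilation[OF w e(1) x]
      by (simp add: weighted_dilation_def set_integral_add(2))
    finally have "weighted_dilation w (\<lambda>t. \<beta> * f t + e t) x =
        \<beta> * weighted_dilation w f x + weighted_dilation w e x" .
    then have "\<beta> * x powr (\<beta> - 1) * weighted_dilation w f x +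
        weighted_dilation w e x / x * x powr \<beta> =
        x powr (\<beta> - 1) * weighted_dilation w (\<lambda>t. \<beta> * f t + e t) x"
      using x by (simp add: powr_diff field_simps)
    then show ?thesis
      using DERIV_mult[OF has_real_derivative_powr[OF x(1), of \<beta>]
          has_derivative_weighted_dilation[OF w \<open>tame f\<close> e(1,3) x]]
      by simp
  qed
  with e(1,2) show ?thesis using that by blast
qed

lemma infinitely_differentiable_powr_weighted_dilation:
  assumes w: "set_integrable lborel {0<..<1} w" and "tame f"
    and F: "\<And>x. 0 < x \<Longrightarrow> x < 1 \<Longrightarrow> F x = x powr \<beta> * weighted_dilation w f x"
  shows "infinitely_differentiable_on F {0<..<1}"
proof -
  have derivative_transfer:
    "(H has_field_derivative x powr (\<gamma> - 1) * weighted_dilation w (\<lambda>t. \<gamma> * h t + e t) x) (at x)"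
    if "\<And>x. 0 < x \<Longrightarrow> x < 1 \<Longrightarrow> H x = x powr \<gamma> * weighted_dilation w h x"
      and "((\<lambda>x. x powr \<gamma> * weighted_dilation w h x) has_field_derivative
        x powr (\<gamma> - 1) * weighted_dilation w (\<lambda>t. \<gamma> * h t + e t) x) (at x)"
      and "0 < x" "x < 1" for H h e \<gamma> x
    by (rule has_field_derivative_transform_within_open[OF that(2), of "{0<..<1}"])
      (use that in auto)
  have shape: "\<exists>h. tame h \<and> (\<forall>x. 0 < x \<longrightarrow> x < 1 \<longrightarrow>
      (deriv ^^ n) F x = x powr (\<beta> - real n) * weighted_dilation w h x)" for n
  proof (induction n)
    case 0
    show ?case using F \<open>tame f\<close> by auto
  next
    case (Suc n)
    then obtain h where h: "tame h" "\<And>x. 0 < x \<Longrightarrow> x < 1 \<Longrightarrow>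
        (deriv ^^ n) F x = x powr (\<beta> - real n) * weighted_dilation w h x"
      by blast
    obtain e where e: "tame e" "\<And>x. 0 < x \<Longrightarrow> x < 1 \<Longrightarrow>
        ((\<lambda>x. x powr (\<beta> - real n) * weighted_dilation w h x) has_field_derivative
          x powr (\<beta> - real n - 1) * weighted_dilation w (\<lambda>t. (\<beta> - real n) * h t + e t) x) (at x)"
      using has_derivative_powr_weighted_dilation[OF w h(1), where \<beta> = "\<beta> - real n"] by blast
    have "tame (\<lambda>t. (\<beta> - real n) * h t + e t)"
      using h(1) e(1) by (intro tame.intros)
    moreover have "(deriv ^^ Suc n) F x = x powr (\<beta> - real (Suc n)) *
        weighted_dilation w (\<lambda>t. (\<beta> - real n) * h t + e t) x" if "0 < x" "x < 1" for x
      using DERIV_imp_deriv[OF derivative_transfer[OF h(2) e(2)[OF that] that]]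
      by (simp add: algebra_simps)
    ultimately show ?case by blast
  qed
  show ?thesis
    unfolding infinitely_differentiable_on_def
  proof (intro allI ballI)
    fix n and x :: real
    assume x: "x \<in> {0<..<1}"
    obtain h where h: "tame h" "\<And>x. 0 < x \<Longrightarrow> x < 1 \<Longrightarrow>
        (deriv ^^ n) F x = x powr (\<beta> - real n) * weighted_dilation w h x"
      using shape by blast
    obtain e where e: "\<And>x. 0 < x \<Longrightarrow> x < 1 \<Longrightarrow>
        ((\<lambda>x. x powr (\<beta> - real n) * weighted_dilation w h x) has_field_derivative
          x powr (\<beta> - real n - 1) * weighted_dilation w (\<lambda>t. (\<beta> - real n) * h t + e t) x) (at x)"
      using has_derivative_powr_weighted_dilation[OF w h(1), where \<beta> = "\<beta> - real n"] by blast
    show "(deriv ^^ n) F field_differentiable (at x)"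
      using derivative_transfer[OF h(2) e, of x] x unfolding field_differentiable_def by auto
  qed
qed

lemma deriv_powr_weighted_dilation_asymptotics:
  assumes w: "set_integrable lborel {0<..<1} w" and "tame f" and L: "(f \<longlongrightarrow> L) (at_right 0)"
    and F: "\<And>x. 0 < x \<Longrightarrow> x < 1 \<Longrightarrow> F x = x powr \<beta> * weighted_dilation w f x"
    and nz: "\<beta> * L * (LBINT u:{0<..<1}. w u) \<noteq> 0"
  shows "deriv F \<sim>[at_right 0] (\<lambda>x. \<beta> * L * (LBINT u:{0<..<1}. w u) * x powr (\<beta> - 1))"
proof (rule asymp_equivI'_const[OF _ nz])
  obtain e where e: "tame e" "(e \<longlongrightarrow> 0) (at_right 0)"
    "\<And>x. 0 < x \<Longrightarrow> x < 1 \<Longrightarrow>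
      ((\<lambda>x. x powr \<beta> * weighted_dilation w f x) has_field_derivative
        x powr (\<beta> - 1) * weighted_dilation w (\<lambda>t. \<beta> * f t + e t) x) (at x)"
    using has_derivative_powr_weighted_dilation[OF w \<open>tame f\<close>, where \<beta> = \<beta>] by blast
  have deriv: "deriv F x = x powr (\<beta> - 1) * weighted_dilation w (\<lambda>t. \<beta> * f t + e t) x"
    if "0 < x" "x < 1" for x
    by (rule DERIV_imp_deriv,
        rule has_field_derivative_transform_within_open[OF e(3)[OF that], of "{0<..<1}"])
      (use F that in auto)
  have "((\<lambda>t. \<beta> * f t + e t) \<longlongrightarrow> \<beta> * L + 0) (at_right 0)"
    by (intro tendsto_intros L e)
  moreover have "tame (\<lambda>t. \<beta> * f t + e t)"
    using \<open>tame f\<close> e(1) by (intro tame.intros)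
  ultimately have "(weighted_dilation w (\<lambda>t. \<beta> * f t + e t) \<longlongrightarrow>
      \<beta> * L * (LBINT u:{0<..<1}. w u)) (at_right 0)"
    using weighted_dilation_tendsto_0[OF w] by fastforce
  moreover have "\<forall>\<^sub>F x in at_right 0. weighted_dilation w (\<lambda>t. \<beta> * f t + e t) x =
      deriv F x / x powr (\<beta> - 1)"
    unfolding eventually_at_right_field by (intro exI[of _ 1]) (auto simp: deriv)
  ultimately show "((\<lambda>x. deriv F x / x powr (\<beta> - 1)) \<longlongrightarrow>
      \<beta> * L * (LBINT u:{0<..<1}. w u)) (at_right 0)"
    by (rule Lim_transform_eventually)
qed

section \<open>The density and the Beta weight\<close>

definition g_denom :: "real \<Rightarrow> real \<Rightarrow> real \<Rightarrow> real" where
  "g_denom \<alpha> p t =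
     p\<^sup>2 * (1 - t) powr (2 * \<alpha>) + (1 - p)\<^sup>2 * t powr (2 * \<alpha>)
       + 2 * p * (1 - p) * t powr \<alpha> * (1 - t) powr \<alpha> * cos (\<alpha> * pi)"

text \<open>
  The denominator is \<open>A\<^sup>2 + B\<^sup>2 + 2 A B cos (\<alpha>\<pi>)\<close> with \<open>A = p (1 - t)\<^sup>\<alpha>\<close> and \<open>B = (1 - p) t\<^sup>\<alpha>\<close>, which
  exceeds \<open>(A - B)\<^sup>2\<close> because \<open>cos (\<alpha>\<pi>) > -1\<close>.
\<close>

lemma g_denom_pos:
  assumes "0 < \<alpha>" "\<alpha> < 1" "0 < p" "p < 1" "0 < t" "t < 1"
  shows "0 < g_denom \<alpha> p t"
proof -
  define A where "A = p * (1 - t) powr \<alpha>"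
  define B where "B = (1 - p) * t powr \<alpha>"
  have AB: "0 < A" "0 < B" using assms by (auto simp: A_def B_def)
  have "cos pi < cos (\<alpha> * pi)"
    using assms by (intro cos_monotone_0_pi) auto
  then have "0 < 2 * (A * B) * (1 + cos (\<alpha> * pi))" using AB by simp
  also have "\<dots> \<le> (A - B)\<^sup>2 + 2 * (A * B) * (1 + cos (\<alpha> * pi))" by simp
  also have "\<dots> = g_denom \<alpha> p t"
    unfolding g_denom_def A_def B_def mult_2 powr_add by (simp add: power2_eq_square algebra_simps)
  finally show ?thesis .
qed

lemma tame_g_denom:
  assumes "0 < \<alpha>"
  shows "tame (g_denom \<alpha> p)"
  unfolding g_denom_def using assms by (intro tame.intros) auto

lemma g_denom_tendsto:
  assumes "0 < \<alpha>"
  shows "(g_denom \<alpha> p \<longlongrightarrow> p\<^sup>2) (at_right 0)"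
proof -
  have "(g_denom \<alpha> p \<longlongrightarrow>
      p\<^sup>2 * 1 + (1 - p)\<^sup>2 * 0 + 2 * p * (1 - p) * 0 * 1 * cos (\<alpha> * pi)) (at_right 0)"
    unfolding g_denom_def using assms
    by (intro tendsto_intros powr_tendsto_0_at_right one_minus_powr_tendsto_1_at_right) auto
  then show ?thesis by simp
qed

definition g_factor :: "real \<Rightarrow> real \<Rightarrow> real \<Rightarrow> real" where
  "g_factor \<alpha> p t = sin (\<alpha> * pi) / pi * (1 - p) * inverse (g_denom \<alpha> p t)"

lemma g_dens_eq_powr_factor: "g_dens \<alpha> p t = t powr \<alpha> * g_factor \<alpha> p t"
  by (simp add: g_dens_def g_factor_def g_denom_def field_simps)

lemma tame_g_factor:
  assumes "0 < \<alpha>" "\<alpha> < 1" "0 < p" "p < 1"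
  shows "tame (g_factor \<alpha> p)"
  unfolding g_factor_def
  using assms g_denom_pos[OF assms]
  by (intro tame.mult tame.const tame.inverse[OF tame_g_denom _ g_denom_tendsto])
    (auto simp: less_imp_neq[symmetric])

lemma g_factor_tendsto:
  assumes "0 < \<alpha>" "0 < p"
  shows "(g_factor \<alpha> p \<longlongrightarrow> sin (\<alpha> * pi) / pi * ((1 - p) / p\<^sup>2)) (at_right 0)"
proof -
  have "(g_factor \<alpha> p \<longlongrightarrow> sin (\<alpha> * pi) / pi * (1 - p) * inverse (p\<^sup>2)) (at_right 0)"
    unfolding g_factor_def using assms by (intro tendsto_intros g_denom_tendsto) auto
  then show ?thesis by (simp add: divide_inverse mult.assoc)
qed

definition beta_weight :: "real \<Rightarrow> real \<Rightarrow> real" where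
  "beta_weight \<alpha> u = u powr \<alpha> * (1 - u) powr (\<alpha> - 1)"

lemma set_integrable_beta_weight:
  assumes "0 < \<alpha>"
  shows "set_integrable lborel {0<..<1} (beta_weight \<alpha>)"
proof -
  have "set_integrable lborel {0..1} (beta_weight \<alpha>)"
    using integrable_Beta[of "\<alpha> + 1" \<alpha>] assms by (simp add: beta_weight_def[abs_def])
  then show ?thesis
    by (rule set_integrable_subset) auto
qed

lemma integral_beta_weight:
  assumes "0 < \<alpha>"
  shows "(LBINT u:{0<..<1}. beta_weight \<alpha> u) = Beta (\<alpha> + 1) \<alpha>"
proof -
  have "(beta_weight \<alpha> has_integral Beta (\<alpha> + 1) \<alpha>) {0..1}"
    using has_integral_Beta_real[of "\<alpha> + 1" \<alpha>] assms by (simp add: beta_weight_def[abs_def])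
  then have "(beta_weight \<alpha> has_integral Beta (\<alpha> + 1) \<alpha>) {0<..<1}"
    by (simp add: has_integral_Icc_iff_Ioo)
  then show ?thesis
    using set_borel_integral_eq_integral(2)[OF set_integrable_beta_weight[OF assms]]
    by (simp add: integral_unique)
qed

lemma Beta_plus1_diagonal:
  assumes "0 < (\<alpha>::real)"
  shows "2 * \<alpha> * Beta (\<alpha> + 1) \<alpha> = \<alpha> * (Gamma \<alpha>)\<^sup>2 / Gamma (2 * \<alpha>)"
proof -
  have "Gamma (\<alpha> + 1) = \<alpha> * Gamma \<alpha>" "Gamma (2 * \<alpha> + 1) = 2 * \<alpha> * Gamma (2 * \<alpha>)"
    using assms by (auto intro!: Gamma_plus1 elim!: nonpos_Ints_cases)
  moreover have "Gamma (2 * \<alpha>) \<noteq> 0" using Gamma_real_pos[of "2 * \<alpha>"] assms by linarith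
  moreover have "\<alpha> + 1 + \<alpha> = 2 * \<alpha> + 1" by simp
  ultimately show ?thesis
    using assms by (simp add: Beta_def power2_eq_square field_simps)
qed

text \<open>
  Substitution \<open>t = x u\<close>: the kernel contributes \<open>x powr (\<alpha> - 1)\<close>, the factor \<open>t powr \<alpha>\<close> of the
  density \<open>x powr \<alpha>\<close>, and the measure \<open>x\<close>.
\<close>

lemma G_distr_eq_weighted_dilation:
  assumes "0 < x"
  shows "G_distr \<alpha> p x = x powr (2 * \<alpha>) * weighted_dilation (beta_weight \<alpha>) (g_factor \<alpha> p) x"
proof -
  have "G_distr \<alpha> p x = (\<integral>t. indicator {0<..<x} t * ((x - t) powr (\<alpha> - 1) * g_dens \<alpha> p t) \<partial>lborel)"
    by (simp add: G_distr_def set_lebesgue_integral_def)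
  also have "\<dots> = x * (\<integral>u. indicator {0<..<x} (x * u) *
      ((x - x * u) powr (\<alpha> - 1) * g_dens \<alpha> p (x * u)) \<partial>lborel)"
    using assms by (subst lborel_integral_real_affine[of x _ 0]) simp_all
  also have "\<dots> = x * (\<integral>u. x powr (2 * \<alpha> - 1) *
      (indicator {0<..<1} u * (beta_weight \<alpha> u * g_factor \<alpha> p (x * u))) \<partial>lborel)"
  proof (intro arg_cong[where f = "\<lambda>y. x * y"] Bochner_Integration.integral_cong refl)
    fix u :: real
    show "indicator {0<..<x} (x * u) * ((x - x * u) powr (\<alpha> - 1) * g_dens \<alpha> p (x * u)) =
        x powr (2 * \<alpha> - 1) * (indicator {0<..<1} u * (beta_weight \<alpha> u * g_factor \<alpha> p (x * u)))"
    proof (cases "0 < u \<and> u < 1")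
      case True
      have "(x - x * u) powr (\<alpha> - 1) = (x * (1 - u)) powr (\<alpha> - 1)"
        by (simp add: algebra_simps)
      also have "\<dots> = x powr (\<alpha> - 1) * (1 - u) powr (\<alpha> - 1)"
        by (rule powr_mult)
      finally have kernel: "(x - x * u) powr (\<alpha> - 1) = x powr (\<alpha> - 1) * (1 - u) powr (\<alpha> - 1)" .
      have "x powr (2 * \<alpha> - 1) = x powr (\<alpha> - 1) * x powr \<alpha>"
        by (simp flip: powr_add)
      moreover have "(x * u) powr \<alpha> = x powr \<alpha> * u powr \<alpha>"
        by (rule powr_mult)
      ultimately show ?thesis
        using assms True by (simp add: kernel g_dens_eq_powr_factor beta_weight_def)
    next
      case False
      then show ?thesis using assms by (auto simp: indicator_def zero_less_mult_iff)
    qed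
  qed
  also have "\<dots> = (x * x powr (2 * \<alpha> - 1)) * weighted_dilation (beta_weight \<alpha>) (g_factor \<alpha> p) x"
    by (simp add: weighted_dilation_def set_lebesgue_integral_def)
  also have "x * x powr (2 * \<alpha> - 1) = x powr (2 * \<alpha>)"
    using assms by (simp add: powr_diff)
  finally show ?thesis .
qed

theorem theorem2p1:
  fixes \<alpha> p :: real
  assumes "0 < \<alpha>" and "\<alpha> < 1" and "0 < p" and "p < 1"
  shows "infinitely_differentiable_on (G_distr \<alpha> p) {0<..<1} \<and>
    deriv (G_distr \<alpha> p) \<sim>[at_right 0]
      (\<lambda>x. sin (\<alpha> * pi) / pi * ((1 - p) / p\<^sup>2) *
            (\<alpha> * (Gamma \<alpha>)\<^sup>2 / Gamma (2 * \<alpha>)) * x powr (2 * \<alpha> - 1))"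
proof
  note w = set_integrable_beta_weight[OF assms(1)]
  note tame = tame_g_factor[OF assms]
  note G = G_distr_eq_weighted_dilation[of _ \<alpha> p]
  show "infinitely_differentiable_on (G_distr \<alpha> p) {0<..<1}"
    using infinitely_differentiable_powr_weighted_dilation[OF w tame G] .
  let ?L = "sin (\<alpha> * pi) / pi * ((1 - p) / p\<^sup>2)"
  have "2 * \<alpha> * ?L * (LBINT u:{0<..<1}. beta_weight \<alpha> u) = ?L * (2 * \<alpha> * Beta (\<alpha> + 1) \<alpha>)"
    using integral_beta_weight[OF assms(1)] by simp
  also have "\<dots> = ?L * (\<alpha> * (Gamma \<alpha>)\<^sup>2 / Gamma (2 * \<alpha>))"
    by (simp only: Beta_plus1_diagonal[OF assms(1)])
  finally have c: "2 * \<alpha> * ?L * (LBINT u:{0<..<1}. beta_weight \<alpha> u) =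
      ?L * (\<alpha> * (Gamma \<alpha>)\<^sup>2 / Gamma (2 * \<alpha>))" .
  have "0 < sin (\<alpha> * pi)" using assms by (intro sin_gt_zero) auto
  moreover have "0 < Gamma \<alpha>" "0 < Gamma (2 * \<alpha>)"
    using assms by (auto intro: Gamma_real_pos)
  ultimately have "0 < ?L * (\<alpha> * (Gamma \<alpha>)\<^sup>2 / Gamma (2 * \<alpha>))"
    using assms by (intro mult_pos_pos divide_pos_pos zero_less_power) auto
  then have "?L * (\<alpha> * (Gamma \<alpha>)\<^sup>2 / Gamma (2 * \<alpha>)) \<noteq> 0" by linarith
  then show "deriv (G_distr \<alpha> p) \<sim>[at_right 0]
      (\<lambda>x. ?L * (\<alpha> * (Gamma \<alpha>)\<^sup>2 / Gamma (2 * \<alpha>)) * x powr (2 * \<alpha> - 1))"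
    using deriv_powr_weighted_dilation_asymptotics[OF w tame g_factor_tendsto[OF assms(1,3)] G]
    unfolding c by blast
qed

end
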